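(* Let $\mathbb F_q$ be a finite field, let $n\ge 1$, and let $$A=\begin{pmatrix}a&b^T\\ b&D\end{pmatrix}$$ be a symmetric $n\times n$ matrix over $\mathbb F_q$, where $a\in\mathbb F_q$, $b\in\mathbb F_q^{n-1}$ and $D$ is a symmetric $(n-1)\times(n-1)$ matrix over $\mathbb F_q$. Then $$\nu_q(A)=\begin{cases}\rho_q(a)\,\nu_q(D-a^{-1}bb^T),&a\neq 0,\\[1mm] 0,&a=0,\ b\neq 0,\\[1mm] \displaystyle\sum_{x\in\mathbb F_q^{n-1}}\nu_q(D-xx^T),&a=0,\ b=0.\end{cases}$$
   Context: For a symmetric $k\times k$ matrix $M$ over $\mathbb F_q$, $\nu_q(M)$ denotes the number of $k\times k$ upper triangular matrices $U$ over $\mathbb F_q$ (not necessarily invertible) with $U^TU=M$. For the empty $0\times 0$ matrix, $\nu_q(\varnothing)=1$. For $a\in\mathbb F_q$, $\rho_q(a)=\#\{u\in\mathbb F_q:u^2=a\}$. Vectors are column vectors. *)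

theory Defs
  imports "Jordan_Normal_Form.Matrix"
begin

text \<open>
  The field with \<open>q\<close> elements is a type of sort \<open>{field, finite}\<close>, and \<open>q\<close> is determined by the
  type. Matrices and vectors carry their dimensions as values (\<open>carrier_mat\<close>, \<open>carrier_vec\<close>),
  including dimension 0.
\<close>

abbreviation col_mat :: "'a vec \<Rightarrow> 'a mat" where
  "col_mat v \<equiv> mat_of_cols (dim_vec v) [v]"

abbreviation symmetric_mat :: "'a mat \<Rightarrow> bool" where
  "symmetric_mat M \<equiv> M\<^sup>T = M"

text \<open>The factor \<open>U\<close> is not required to be invertible.\<close>

definition cholesky_factors :: "'a :: {field, finite} mat \<Rightarrow> 'a mat set" where
  "cholesky_factors M =
     {U \<in> carrier_mat (dim_row M) (dim_row M). upper_triangular U \<and> U\<^sup>T * U = M}"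

definition \<nu> :: "'a :: {field, finite} mat \<Rightarrow> nat" where
  "\<nu> M = card (cholesky_factors M)"

definition \<rho> :: "'a :: {field, finite} \<Rightarrow> nat" where
  "\<rho> a = card {u. u ^ 2 = a}"

text \<open>
  Cardinalities and sums over infinite sets are 0 by convention; the following two facts
  show that this convention is never triggered here.
\<close>

lemma finite_carrier_vec_finite: "finite (carrier_vec n :: 'a :: finite vec set)"
proof -
  have "carrier_vec n \<subseteq> vec_of_list ` {xs :: 'a list. set xs \<subseteq> UNIV \<and> length xs = n}"
  proof
    fix v :: "'a vec" assume "v \<in> carrier_vec n"
    then show "v \<in> vec_of_list ` {xs. set xs \<subseteq> UNIV \<and> length xs = n}"
      by (intro image_eqI[of _ _ "list_of_vec v"]) (auto simp: vec_list)
  qed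
  then show ?thesis
    by (rule finite_subset) (intro finite_imageI finite_lists_length_eq finite)
qed

lemma finite_cholesky_factors: "finite (cholesky_factors M)"
proof -
  let ?k = "dim_row M"
  have "cholesky_factors M
      \<subseteq> mat_of_rows ?k ` {rs. set rs \<subseteq> carrier_vec ?k \<and> length rs = ?k}"
  proof
    fix U assume "U \<in> cholesky_factors M"
    then have U: "U \<in> carrier_mat ?k ?k" by (simp add: cholesky_factors_def)
    then have "U = mat_of_rows ?k (rows U)" by (metis carrier_matD(2) mat_of_rows_rows)
    moreover have "set (rows U) \<subseteq> carrier_vec ?k" "length (rows U) = ?k"
      using U rows_carrier[of U] by auto
    ultimately show "U \<in> mat_of_rows ?k ` {rs. set rs \<subseteq> carrier_vec ?k \<and> length rs = ?k}"
      by blast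
  qed
  then show ?thesis
    by (rule finite_subset)
      (intro finite_imageI finite_lists_length_eq finite_carrier_vec_finite)
qed

lemma nu_empty:
  assumes "M \<in> carrier_mat 0 0"
  shows "\<nu> M = 1"
proof -
  have "cholesky_factors M = {M}"
    using assms by (auto simp: cholesky_factors_def intro!: eq_matI)
  then show ?thesis by (simp add: \<nu>_def)
qed

end

theory Submission
  imports Defs
begin

text \<open>
  An upper triangular matrix of size \<open>m + 1\<close> has the form
  \<open>U = (u, x\<^sup>T; 0, V)\<close> for a unique scalar \<open>u\<close>, a unique vector \<open>x\<close> of length \<open>m\<close> and a
  unique upper triangular \<open>V\<close> of size \<open>m\<close>. Block multiplication gives
  \<open>U\<^sup>T U = (u\<^sup>2, u x\<^sup>T; u x, x x\<^sup>T + V\<^sup>T V)\<close>, so \<open>U\<close> is a factor of \<open>A = (a, b\<^sup>T; b, D)\<close> exactly when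
  \<open>u\<^sup>2 = a\<close>, \<open>u x = b\<close> and \<open>V\<close> is a factor of \<open>D - x x\<^sup>T\<close>. Hence \<open>\<nu> A\<close> is the sum of
  \<open>\<nu> (D - x x\<^sup>T)\<close> over all first rows \<open>(u, x)\<close> with \<open>u\<^sup>2 = a\<close> and \<open>u x = b\<close>; this is
  \<open>nu_four_block_mat\<close>, which rests on \<open>upper_triangular_borderedE\<close>, \<open>bordered_inject\<close> and
  \<open>gram_bordered\<close>.

  The three cases of the theorem describe the admissible first rows. If \<open>a \<noteq> 0\<close>, then every root
  \<open>u\<close> of \<open>a\<close> is invertible and determines \<open>x = u\<^sup>-\<^sup>1 b\<close>, and \<open>x x\<^sup>T = a\<^sup>-\<^sup>1 b b\<^sup>T\<close> does not depend on
  the root, so all \<open>\<rho> a\<close> summands agree. If \<open>a = 0\<close>, then \<open>u = 0\<close>, which forces \<open>b = 0\<close> and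
  then leaves \<open>x\<close> arbitrary.
\<close>

definition bordered :: "'a :: zero \<Rightarrow> 'a vec \<Rightarrow> 'a mat \<Rightarrow> 'a mat" where
  "bordered u x V =
     four_block_mat (mat 1 1 (\<lambda>_. u)) ((col_mat x)\<^sup>T) (0\<^sub>m (dim_vec x) 1) V"

text \<open>
  The dimension is written \<open>Suc 0\<close> and the row count \<open>m\<close> is independent of \<open>x\<close>, because this is
  the form that simplification gives to a \<open>col_mat\<close> whose vector lies in a known carrier.
\<close>

lemma mat_of_cols_singleton_carrier [simp]: "mat_of_cols m [x] \<in> carrier_mat m (Suc 0)"
  by (rule carrier_matI) simp_all

lemma outer_product_carrier [simp]:
  "mat_of_cols m [x] * (mat_of_cols m [x])\<^sup>T \<in> carrier_mat m m"
  by (rule carrier_matI) simp_all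

text \<open>
  In the case \<open>a \<noteq> 0\<close>, with \<open>c = u\<^sup>-\<^sup>1\<close>, only \<open>c\<^sup>2 = a\<^sup>-\<^sup>1\<close> survives: the choice of the root \<open>u\<close>
  disappears from the outer product.
\<close>

lemma outer_product_smult:
  fixes x :: "'a :: comm_ring_1 vec"
  shows "col_mat (c \<cdot>\<^sub>v x) * (col_mat (c \<cdot>\<^sub>v x))\<^sup>T = c ^ 2 \<cdot>\<^sub>m (col_mat x * (col_mat x)\<^sup>T)"
  by (rule eq_matI) (auto simp: scalar_prod_def mat_of_cols_index power2_eq_square)

lemma four_block_mat_inject:
  assumes "P \<in> carrier_mat k l" "P' \<in> carrier_mat k l"
    and "Q \<in> carrier_mat k c" "Q' \<in> carrier_mat k c"
    and "R \<in> carrier_mat r l" "R' \<in> carrier_mat r l"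
    and "S \<in> carrier_mat r c" "S' \<in> carrier_mat r c"
  shows "four_block_mat P Q R S = four_block_mat P' Q' R' S'
    \<longleftrightarrow> P = P' \<and> Q = Q' \<and> R = R' \<and> S = S'" (is "?M = ?M' \<longleftrightarrow> _")
proof
  assume eq: "?M = ?M'"
  have entry: "?M $$ (i, j) = ?M' $$ (i, j)" for i j
    by (simp add: eq)
  have "P $$ (i, j) = P' $$ (i, j)" if "i < k" "j < l" for i j
    using entry[of i j] that assms by simp
  moreover have "Q $$ (i, j) = Q' $$ (i, j)" if "i < k" "j < c" for i j
    using entry[of i "l + j"] that assms by simp
  moreover have "R $$ (i, j) = R' $$ (i, j)" if "i < r" "j < l" for i j
    using entry[of "k + i" j] that assms by simp
  moreover have "S $$ (i, j) = S' $$ (i, j)" if "i < r" "j < c" for i j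
    using entry[of "k + i" "l + j"] that assms by simp
  ultimately show "P = P' \<and> Q = Q' \<and> R = R' \<and> S = S'"
    using assms by (auto intro!: eq_matI)
qed simp

lemma mat_1_1_inject: "mat 1 1 (\<lambda>_. u) = mat 1 1 (\<lambda>_. v) \<longleftrightarrow> u = v"
proof
  assume "mat 1 1 (\<lambda>_. u) = mat 1 1 (\<lambda>_. v)"
  then have "mat 1 1 (\<lambda>_. u) $$ (0, 0) = mat 1 1 (\<lambda>_. v) $$ (0, 0)"
    by simp
  then show "u = v" by simp
qed simp

lemma mat_of_cols_singleton_inject:
  assumes "x \<in> carrier_vec m" "y \<in> carrier_vec m"
  shows "mat_of_cols m [x] = mat_of_cols m [y] \<longleftrightarrow> x = y"
proof
  assume eq: "mat_of_cols m [x] = mat_of_cols m [y]"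
  show "x = y"
  proof (rule eq_vecI)
    fix i assume i: "i < dim_vec y"
    have "mat_of_cols m [x] $$ (i, 0) = mat_of_cols m [y] $$ (i, 0)" by (simp only: eq)
    then show "x $ i = y $ i" using i assms by (simp add: mat_of_cols_index)
  qed (use assms in simp)
qed simp

lemma mat_add_eq_iff_eq_minus:
  fixes X Y Z :: "'a :: ab_group_add mat"
  assumes "X \<in> carrier_mat r c" "Y \<in> carrier_mat r c" "Z \<in> carrier_mat r c"
  shows "X + Y = Z \<longleftrightarrow> Y = Z - X"
proof
  assume "X + Y = Z"
  with assms show "Y = Z - X" by (auto intro!: eq_matI)
next
  assume "Y = Z - X"
  with assms show "X + Y = Z" by (auto intro!: eq_matI)
qed

lemma bordered_inject:
  assumes "x \<in> carrier_vec m" "y \<in> carrier_vec m" "V \<in> carrier_mat m m" "W \<in> carrier_mat m m"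
  shows "bordered u x V = bordered v y W \<longleftrightarrow> u = v \<and> x = y \<and> V = W"
proof -
  have "bordered u x V = bordered v y W \<longleftrightarrow>
      mat 1 1 (\<lambda>_. u) = mat 1 1 (\<lambda>_. v) \<and> (col_mat x)\<^sup>T = (col_mat y)\<^sup>T
      \<and> 0\<^sub>m (dim_vec x) 1 = (0\<^sub>m (dim_vec y) 1 :: 'a mat) \<and> V = W"
    unfolding bordered_def
    by (rule four_block_mat_inject[where k = 1 and l = 1 and c = m and r = m])
      (use assms in simp_all)
  then show ?thesis
    using assms by (simp add: mat_1_1_inject mat_of_cols_singleton_inject del: One_nat_def)
qed

lemma upper_triangular_bordered:
  assumes "x \<in> carrier_vec m" "V \<in> carrier_mat m m" "upper_triangular V"
  shows "bordered u x V \<in> carrier_mat (Suc m) (Suc m)" "upper_triangular (bordered u x V)"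
proof -
  show "bordered u x V \<in> carrier_mat (Suc m) (Suc m)"
    using assms by (auto simp: bordered_def)
  show "upper_triangular (bordered u x V)"
    using assms by (auto simp: bordered_def upper_triangular_def)
qed

text \<open>
  The first column of \<open>U\<close> vanishes below the corner, so the first row and the trailing block
  carry all of \<open>U\<close>.
\<close>

lemma upper_triangular_borderedE:
  assumes "U \<in> carrier_mat (Suc m) (Suc m)" "upper_triangular U"
  obtains u x V where "x \<in> carrier_vec m" "V \<in> carrier_mat m m" "upper_triangular V"
    "U = bordered u x V"
proof
  let ?x = "vec m (\<lambda>j. U $$ (0, Suc j))" and ?V = "mat m m (\<lambda>(i, j). U $$ (Suc i, Suc j))"
  show "?x \<in> carrier_vec m" "?V \<in> carrier_mat m m" by simp_all
  show "upper_triangular ?V" using assms by (auto simp: upper_triangular_def)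
  show "U = bordered (U $$ (0, 0)) ?x ?V"
    using assms
    by (intro eq_matI) (auto simp: bordered_def mat_of_cols_index upper_triangular_def)
qed

lemma gram_bordered:
  fixes u :: "'a :: comm_ring_1"
  assumes x: "x \<in> carrier_vec m" and V: "V \<in> carrier_mat m m"
  shows "(bordered u x V)\<^sup>T * bordered u x V =
    four_block_mat (mat 1 1 (\<lambda>_. u ^ 2)) ((col_mat (u \<cdot>\<^sub>v x))\<^sup>T)
      (col_mat (u \<cdot>\<^sub>v x)) (col_mat x * (col_mat x)\<^sup>T + V\<^sup>T * V)"
proof -
  have corner_T: "(mat 1 1 (\<lambda>_. u))\<^sup>T = mat 1 1 (\<lambda>_. u)"
    by (rule eq_matI) simp_all
  have T: "(bordered u x V)\<^sup>T =
      four_block_mat (mat 1 1 (\<lambda>_. u)) (0\<^sub>m 1 m) (col_mat x) (V\<^sup>T)"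
    unfolding bordered_def using x V
    by (subst transpose_four_block_mat[of _ 1 1 _ m _ m])
      (simp_all add: corner_T[simplified])
  have corner: "mat 1 1 (\<lambda>_. u) * mat 1 1 (\<lambda>_. u) + 0\<^sub>m 1 m * 0\<^sub>m m 1 = mat 1 1 (\<lambda>_. u ^ 2)"
    by (rule eq_matI) (auto simp: scalar_prod_def power2_eq_square)
  have row: "mat 1 1 (\<lambda>_. u) * (col_mat x)\<^sup>T + 0\<^sub>m 1 m * V = (col_mat (u \<cdot>\<^sub>v x))\<^sup>T"
    using x V by (intro eq_matI) (auto simp: scalar_prod_def mat_of_cols_index)
  have col: "col_mat x * mat 1 1 (\<lambda>_. u) + V\<^sup>T * 0\<^sub>m m 1 = col_mat (u \<cdot>\<^sub>v x)"
    using x V by (intro eq_matI) (auto simp: scalar_prod_def mat_of_cols_index)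
  have B: "bordered u x V =
      four_block_mat (mat 1 1 (\<lambda>_. u)) ((col_mat x)\<^sup>T) (0\<^sub>m m 1) V"
    using x by (simp add: bordered_def)
  have "(bordered u x V)\<^sup>T * bordered u x V = four_block_mat
      (mat 1 1 (\<lambda>_. u) * mat 1 1 (\<lambda>_. u) + 0\<^sub>m 1 m * 0\<^sub>m m 1)
      (mat 1 1 (\<lambda>_. u) * (col_mat x)\<^sup>T + 0\<^sub>m 1 m * V)
      (col_mat x * mat 1 1 (\<lambda>_. u) + V\<^sup>T * 0\<^sub>m m 1)
      (col_mat x * (col_mat x)\<^sup>T + V\<^sup>T * V)"
    unfolding T unfolding B
    \<comment> \<open>The block sizes are spelled out so that the carrier conditions contain no unknowns.\<close>
    by (rule mult_four_block_mat[of _ 1 1 _ m _ m _ _ 1 _ m]) (use x V in simp_all)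
  then show ?thesis by (simp only: corner row col)
qed

text \<open>
  The decomposition of \<open>U\<close> into its first row \<open>(u, x)\<close> and its trailing block \<open>V\<close> fibres the factors
  of the block matrix over the admissible first rows, and the fibre over \<open>(u, x)\<close> consists of the
  factors of \<open>D - x x\<^sup>T\<close>.
\<close>

lemma nu_four_block_mat:
  fixes D :: "'a :: {field, finite} mat"
  assumes b: "b \<in> carrier_vec m" and D: "D \<in> carrier_mat m m"
  shows "\<nu> (four_block_mat (mat 1 1 (\<lambda>_. a)) ((col_mat b)\<^sup>T) (col_mat b) D) =
    (\<Sum>(u, x) \<in> {(u, x). x \<in> carrier_vec m \<and> u ^ 2 = a \<and> u \<cdot>\<^sub>v x = b}.
       \<nu> (D - col_mat x * (col_mat x)\<^sup>T))"
    (is "\<nu> ?A = (\<Sum>_ \<in> ?P. _)")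
proof -
  let ?F = "\<lambda>(u, x). cholesky_factors (D - col_mat x * (col_mat x)\<^sup>T)"
  let ?f = "\<lambda>((u, x), V). bordered u x V"
  have A: "dim_row ?A = Suc m" using D by simp
  have block: "(bordered u x V)\<^sup>T * bordered u x V = ?A \<longleftrightarrow>
      u ^ 2 = a \<and> u \<cdot>\<^sub>v x = b \<and> V\<^sup>T * V = D - col_mat x * (col_mat x)\<^sup>T"
    if x: "x \<in> carrier_vec m" and V: "V \<in> carrier_mat m m" for u x V
  proof -
    have xx: "col_mat x * (col_mat x)\<^sup>T \<in> carrier_mat m m"
      using x by simp
    have VV: "V\<^sup>T * V \<in> carrier_mat m m" using V by simp
    have "(bordered u x V)\<^sup>T * bordered u x V = ?A \<longleftrightarrow>
        mat 1 1 (\<lambda>_. u ^ 2) = mat 1 1 (\<lambda>_. a) \<and> (col_mat (u \<cdot>\<^sub>v x))\<^sup>T = (col_mat b)\<^sup>T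
        \<and> col_mat (u \<cdot>\<^sub>v x) = col_mat b \<and> col_mat x * (col_mat x)\<^sup>T + V\<^sup>T * V = D"
      unfolding gram_bordered[OF x V]
      by (rule four_block_mat_inject[where k = 1 and l = 1 and c = m and r = m])
        (use x b D V in simp_all)
    moreover have "col_mat x * (col_mat x)\<^sup>T + V\<^sup>T * V = D \<longleftrightarrow>
        V\<^sup>T * V = D - col_mat x * (col_mat x)\<^sup>T"
      using xx VV D by (rule mat_add_eq_iff_eq_minus)
    moreover have "col_mat (u \<cdot>\<^sub>v x) = col_mat b \<longleftrightarrow> u \<cdot>\<^sub>v x = b"
      using x b by (simp add: mat_of_cols_singleton_inject)
    ultimately show ?thesis by (auto simp only: mat_1_1_inject)
  qed
  have dimF: "dim_row (D - col_mat x * (col_mat x)\<^sup>T) = m" if "x \<in> carrier_vec m" for x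
    using that by simp
  have "cholesky_factors ?A = ?f ` (SIGMA p : ?P. ?F p)"
  proof (intro equalityI subsetI)
    fix U assume "U \<in> cholesky_factors ?A"
    then have U: "U \<in> carrier_mat (Suc m) (Suc m)" "upper_triangular U" "U\<^sup>T * U = ?A"
      unfolding cholesky_factors_def A by auto
    obtain u x V where x: "x \<in> carrier_vec m" and V: "V \<in> carrier_mat m m" "upper_triangular V"
      and Ueq: "U = bordered u x V"
      using upper_triangular_borderedE[OF U(1,2)] .
    have eqs: "u ^ 2 = a \<and> u \<cdot>\<^sub>v x = b \<and> V\<^sup>T * V = D - col_mat x * (col_mat x)\<^sup>T"
      using U(3) block[OF x V(1)] unfolding Ueq by blast
    then have "V \<in> ?F (u, x)"
      using V dimF[OF x] unfolding cholesky_factors_def by simp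
    then show "U \<in> ?f ` (SIGMA p : ?P. ?F p)"
      using x eqs by (intro image_eqI[of _ _ "((u, x), V)"]) (auto simp: Ueq)
  next
    fix U assume "U \<in> ?f ` (SIGMA p : ?P. ?F p)"
    then obtain u x V where x: "x \<in> carrier_vec m" and ux: "u ^ 2 = a" "u \<cdot>\<^sub>v x = b"
      and "V \<in> cholesky_factors (D - col_mat x * (col_mat x)\<^sup>T)" and Ueq: "U = bordered u x V"
      by auto
    then have V: "V \<in> carrier_mat m m" "upper_triangular V"
        "V\<^sup>T * V = D - col_mat x * (col_mat x)\<^sup>T"
      unfolding cholesky_factors_def dimF[OF x] by auto
    show "U \<in> cholesky_factors ?A"
      unfolding cholesky_factors_def A Ueq
      using upper_triangular_bordered[OF x V(1,2)] block[OF x V(1)] ux V(3) by blast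
  qed
  moreover have "inj_on ?f (SIGMA p : ?P. ?F p)"
  proof (rule inj_onI)
    fix s t assume s: "s \<in> (SIGMA p : ?P. ?F p)" and t: "t \<in> (SIGMA p : ?P. ?F p)"
      and eq: "?f s = ?f t"
    obtain u x V where s_eq: "s = ((u, x), V)" and x: "x \<in> carrier_vec m" and V: "V \<in> ?F (u, x)"
      using s by blast
    obtain v y W where t_eq: "t = ((v, y), W)" and y: "y \<in> carrier_vec m" and W: "W \<in> ?F (v, y)"
      using t by blast
    have "V \<in> carrier_mat m m" "W \<in> carrier_mat m m"
      using V W unfolding cholesky_factors_def by (simp_all only: prod.case dimF x y mem_Collect_eq)
    then show "s = t"
      using eq x y by (simp add: s_eq t_eq bordered_inject)
  qed
  moreover have "finite ?P"
    by (rule finite_subset[of _ "UNIV \<times> carrier_vec m"])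
      (auto intro: finite_carrier_vec_finite)
  ultimately have "\<nu> ?A = (\<Sum>p \<in> ?P. card (?F p))"
    unfolding \<nu>_def
    by (simp only: card_image) (rule card_SigmaI, auto simp: finite_cholesky_factors)
  also have "\<dots> = (\<Sum>(u, x) \<in> ?P. \<nu> (D - col_mat x * (col_mat x)\<^sup>T))"
    by (rule sum.cong) (auto simp: \<nu>_def)
  finally show ?thesis .
qed

theorem theorem3p1:
  fixes A D :: "'a :: {field, finite} mat" and a :: 'a and b :: "'a vec" and n :: nat
  assumes "n \<ge> 1"
    and "A \<in> carrier_mat n n" and "symmetric_mat A"
    and "b \<in> carrier_vec (n - 1)"
    and "D \<in> carrier_mat (n - 1) (n - 1)" and "symmetric_mat D"
    and "A = four_block_mat (mat 1 1 (\<lambda>_. a)) ((col_mat b)\<^sup>T)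
                            (col_mat b)             D"
  shows "\<nu> A =
    (if a \<noteq> 0 then \<rho> a * \<nu> (D - inverse a \<cdot>\<^sub>m (col_mat b * (col_mat b)\<^sup>T))
     else if b \<noteq> 0\<^sub>v (n - 1) then 0
     else (\<Sum>x \<in> carrier_vec (n - 1). \<nu> (D - col_mat x * (col_mat x)\<^sup>T)))"
proof -
  define m where "m = n - 1"
  note b = \<open>b \<in> carrier_vec (n - 1)\<close>[folded m_def]
  define P where "P = {(u, x). x \<in> carrier_vec m \<and> u ^ 2 = a \<and> u \<cdot>\<^sub>v x = b}"
  have nuA: "\<nu> A = (\<Sum>(u, x) \<in> P. \<nu> (D - col_mat x * (col_mat x)\<^sup>T))"
    using assms(5) b unfolding P_def \<open>A = _\<close> m_def by (intro nu_four_block_mat)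
  consider "a \<noteq> 0" | "a = 0" "b \<noteq> 0\<^sub>v m" | "a = 0" "b = 0\<^sub>v m" by blast
  then show ?thesis
  proof cases
    case 1
    have "P = (\<lambda>u. (u, inverse u \<cdot>\<^sub>v b)) ` {u. u ^ 2 = a}"
    proof (intro equalityI subsetI)
      fix p assume "p \<in> P"
      then obtain u x where p: "p = (u, x)" and u: "u ^ 2 = a" and ux: "u \<cdot>\<^sub>v x = b"
        by (auto simp: P_def)
      have "u \<noteq> 0" using u 1 by auto
      then have "inverse u \<cdot>\<^sub>v b = x" by (simp add: ux[symmetric] smult_smult_assoc)
      then show "p \<in> (\<lambda>u. (u, inverse u \<cdot>\<^sub>v b)) ` {u. u ^ 2 = a}"
        using p u by auto
    next
      fix p assume "p \<in> (\<lambda>u. (u, inverse u \<cdot>\<^sub>v b)) ` {u. u ^ 2 = a}"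
      then obtain u where p: "p = (u, inverse u \<cdot>\<^sub>v b)" and u: "u ^ 2 = a" by auto
      have "u \<noteq> 0" using u 1 by auto
      then show "p \<in> P" using p u b by (simp add: P_def smult_smult_assoc)
    qed
    moreover have "inj_on (\<lambda>u. (u, inverse u \<cdot>\<^sub>v b)) {u. u ^ 2 = a}"
      by (auto intro: inj_onI)
    ultimately have "\<nu> A = (\<Sum>u \<in> {u. u ^ 2 = a}.
        \<nu> (D - col_mat (inverse u \<cdot>\<^sub>v b) * (col_mat (inverse u \<cdot>\<^sub>v b))\<^sup>T))"
      by (simp add: nuA sum.reindex)
    also have "\<dots> = (\<Sum>u \<in> {u. u ^ 2 = a}.
        \<nu> (D - inverse a \<cdot>\<^sub>m (col_mat b * (col_mat b)\<^sup>T)))"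
      unfolding outer_product_smult by (rule sum.cong) (auto simp: power_inverse)
    also have "\<dots> = \<rho> a * \<nu> (D - inverse a \<cdot>\<^sub>m (col_mat b * (col_mat b)\<^sup>T))"
      by (simp add: \<rho>_def)
    finally show ?thesis using 1 by simp
  next
    case 2
    then have "P = {}" by (auto simp: P_def)
    then show ?thesis using 2 by (simp add: nuA m_def)
  next
    case 3
    then have "P = {0} \<times> carrier_vec m" by (auto simp: P_def)
    then show ?thesis using 3 by (simp add: nuA m_def sum.cartesian_product[symmetric])
  qed
qed

end
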